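(* Let $C = c_2t^2 + c_1t + c_0 \in \mathbb{S}[t]$ be a quadratic polynomial over the split quaternions $\mathbb{S}$ with invertible leading coefficient $c_2$. If the vectors $c_0$, $c_1$, $c_2$ of the real vector space $\mathbb{S}$ are linearly independent, then $C$ admits a factorization, i.e., there exist $h_1, h_2 \in \mathbb{S}$ such that $C = c_2(t-h_1)(t-h_2)$.
   Context: The split quaternions $\mathbb{S}$ are the associative real algebra with basis $1, \mathbf{i}_s, \mathbf{j}_s, \mathbf{k}_s$, realized as the even subalgebra of the Clifford algebra generated by pairwise anticommuting $e_1,e_2,e_3$ with $e_1^2=1$, $e_2^2=e_3^2=-1$, via $\mathbf{i}_s = e_1e_2$, $\mathbf{j}_s=e_1e_3$, $\mathbf{k}_s = e_2e_3$. Thus $\mathbf{i}_s^2=\mathbf{j}_s^2=1$, $\mathbf{k}_s^2=-1$, $\mathbf{j}_s\mathbf{i}_s=-\mathbf{i}_s\mathbf{j}_s=\mathbf{k}_s$, $\mathbf{j}_s\mathbf{k}_s=-\mathbf{k}_s\mathbf{j}_s=\mathbf{i}_s$, $\mathbf{k}_s\mathbf{i}_s=-\mathbf{i}_s\mathbf{k}_s=\mathbf{j}_s$. $\mathbb{S}[t]$ is the ring of polynomials in an indeterminate $t$ with coefficients in $\mathbb{S}$ (written on the left), where $t$ commutes with all coefficients: $\left(\sum_i a_it^i\right)\left(\sum_j b_jt^j\right)=\sum_{i,j}a_ib_jt^{i+j}$. *)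

theory Defs
  imports Complex_Main "HOL-Library.Poly_Mapping"
begin

(* SQuat a b c d stands for a + b i + c j + d k, where i = e1 e2, j = e1 e3, k = e2 e3
   in the Clifford algebra with e1^2 = 1, e2^2 = e3^2 = -1. *)
datatype squat = SQuat (sq_Re: real) (sq_I: real) (sq_J: real) (sq_K: real)

lemma squat_eq_iff:
  "x = y \<longleftrightarrow> sq_Re x = sq_Re y \<and> sq_I x = sq_I y \<and> sq_J x = sq_J y \<and> sq_K x = sq_K y"
  by (cases x; cases y) simp

instantiation squat :: real_vector
begin

definition "0 = SQuat 0 0 0 0"
definition "x + y = SQuat (sq_Re x + sq_Re y) (sq_I x + sq_I y) (sq_J x + sq_J y) (sq_K x + sq_K y)"
definition "x - y = SQuat (sq_Re x - sq_Re y) (sq_I x - sq_I y) (sq_J x - sq_J y) (sq_K x - sq_K y)"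
definition "- x = SQuat (- sq_Re x) (- sq_I x) (- sq_J x) (- sq_K x)"
definition "r *\<^sub>R x = SQuat (r * sq_Re x) (r * sq_I x) (r * sq_J x) (r * sq_K x)"

instance
  by standard
    (auto simp: zero_squat_def plus_squat_def minus_squat_def uminus_squat_def
      scaleR_squat_def squat_eq_iff algebra_simps)

end

(* Bilinear extension of i i = j j = 1, k k = -1, j i = - i j = k, j k = - k j = i,
   k i = - i k = j; see the multiplication table below. *)
instantiation squat :: real_algebra_1
begin

definition "1 = SQuat 1 0 0 0"
definition "x * y = SQuat
  (sq_Re x * sq_Re y + sq_I x * sq_I y + sq_J x * sq_J y - sq_K x * sq_K y)
  (sq_Re x * sq_I y + sq_I x * sq_Re y + sq_J x * sq_K y - sq_K x * sq_J y)
  (sq_Re x * sq_J y + sq_J x * sq_Re y + sq_K x * sq_I y - sq_I x * sq_K y)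
  (sq_Re x * sq_K y + sq_K x * sq_Re y + sq_J x * sq_I y - sq_I x * sq_J y)"

instance
  by standard
    (auto simp: zero_squat_def one_squat_def plus_squat_def scaleR_squat_def times_squat_def
      squat_eq_iff algebra_simps)

end

definition sqi :: squat where "sqi = SQuat 0 1 0 0"
definition sqj :: squat where "sqj = SQuat 0 0 1 0"
definition sqk :: squat where "sqk = SQuat 0 0 0 1"

lemma squat_basis_mult:
  "sqi * sqi = 1" "sqj * sqj = 1" "sqk * sqk = - 1"
  "sqj * sqi = sqk" "sqi * sqj = - sqk"
  "sqj * sqk = sqi" "sqk * sqj = - sqi"
  "sqk * sqi = sqj" "sqi * sqk = - sqj"
  by (simp_all add: sqi_def sqj_def sqk_def times_squat_def one_squat_def uminus_squat_def)

lemma squat_expand: "SQuat a b c d = a *\<^sub>R 1 + b *\<^sub>R sqi + c *\<^sub>R sqj + d *\<^sub>R sqk"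
  by (simp add: sqi_def sqj_def sqk_def one_squat_def plus_squat_def scaleR_squat_def)

(* The type 'a poly is a ring only for commutative coefficients, so polynomials are represented
   as finitely supported coefficient functions with the convolution product of Poly_Mapping. *)
type_synonym squat_poly = "nat \<Rightarrow>\<^sub>0 squat"

abbreviation const :: "squat \<Rightarrow> squat_poly" where
  "const a \<equiv> Poly_Mapping.single 0 a"

abbreviation indet :: squat_poly where
  "indet \<equiv> Poly_Mapping.single 1 1"

lemma indet_power: "indet ^ n = Poly_Mapping.single n 1"
  by (induction n) (simp_all add: mult_single)

lemma monomial_mult:
  "(const a * indet ^ m) * (const b * indet ^ n) = const (a * b) * indet ^ (m + n)"
  unfolding indet_power by (simp add: mult_single)

lemma lookup_quadratic:
  "Poly_Mapping.lookup (const c2 * indet ^ 2 + const c1 * indet + const c0) n =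
    (if n = 0 then c0 else if n = 1 then c1 else if n = 2 then c2 else 0)"
  unfolding indet_power by (simp add: mult_single lookup_add lookup_single when_def)

end

theory Submission
  imports Defs "HOL-Computational_Algebra.Fundamental_Theorem_Algebra"
begin

text \<open>
  Dividing by \<open>c2\<close> leaves a monic polynomial \<open>P = t\<^sup>2 + b t + c\<close> with \<open>1\<close>, \<open>b\<close>, \<open>c\<close> linearly
  independent, and \<open>P = (t - h1) (t - h2)\<close> with \<open>h1 = - b - h2\<close> as soon as
  \<open>h2\<^sup>2 + b h2 + c = 0\<close>. So the task is to find a right root of \<open>P\<close>.

  The norm polynomial of \<open>P\<close> is a real monic quartic, hence a product of two real quadratics
  \<open>M = t\<^sup>2 - \<tau> t + \<delta>\<close> and \<open>M' = t\<^sup>2 + m t + n\<close>. The remainder of \<open>P\<close> modulo \<open>M\<close> is \<open>R = p t + q\<close>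
  with \<open>p = b + \<tau>\<close> and \<open>q = c - \<delta>\<close>, and any \<open>h\<close> with \<open>M(h) = 0\<close> and \<open>p h + q = 0\<close> is a right
  root. Since \<open>M\<close> divides the norm of \<open>P = M + R\<close>, it divides the norm of \<open>R\<close>, which has degree
  at most two and therefore equals \<open>k M\<close>, where \<open>k\<close> is the norm of \<open>p\<close>.

  If \<open>k \<noteq> 0\<close>, then \<open>h = - p\<^sup>-\<^sup>1 q\<close> has the characteristic polynomial \<open>M\<close> and is a right root
  (\<open>right_root_if_invertible\<close>).

  If \<open>k = 0\<close>, then \<open>p\<close> and \<open>q\<close> span a plane on which the norm vanishes identically. Under the
  identification of the split quaternions with the real \<open>2 \<times> 2\<close> matrices, where the norm is the
  determinant, there are two kinds of such planes: matrices with a common image, where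
  \<open>cnj p * q = 0\<close>, and matrices with a common kernel, where \<open>p * cnj q = 0\<close>
  (\<open>null_plane_cases\<close>). For a common image, the equation \<open>p h = - q\<close> is solvable, and
  its solutions leave just enough freedom to prescribe trace and norm of \<open>h\<close>, hence to get
  \<open>M(h) = 0\<close> (\<open>right_root_if_common_image\<close>); this uses that \<open>p\<close> and \<open>q\<close> are independent.
  For a common kernel, exchanging \<open>M\<close> and \<open>M'\<close> replaces \<open>p\<close> and \<open>q\<close> by
  \<open>- cnj p\<close> and \<open>- cnj q\<close>, which leads back to a common image.
\<close>

section \<open>Conjugation, norm and trace form\<close>

definition sq_cnj :: "squat \<Rightarrow> squat" where
  "sq_cnj x = SQuat (sq_Re x) (- sq_I x) (- sq_J x) (- sq_K x)"

definition sq_norm :: "squat \<Rightarrow> real" where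
  "sq_norm x = (sq_Re x)\<^sup>2 - (sq_I x)\<^sup>2 - (sq_J x)\<^sup>2 + (sq_K x)\<^sup>2"

text \<open>
  The polar form of the norm; \<open>sq_polar 1 x\<close> is the trace \<open>x + sq_cnj x\<close> of \<open>x\<close>.
\<close>

definition sq_polar :: "squat \<Rightarrow> squat \<Rightarrow> real" where
  "sq_polar x y = 2 * (sq_Re x * sq_Re y - sq_I x * sq_I y - sq_J x * sq_J y + sq_K x * sq_K y)"

lemmas squat_coordinates = zero_squat_def one_squat_def plus_squat_def minus_squat_def
  uminus_squat_def scaleR_squat_def times_squat_def sq_cnj_def sq_norm_def sq_polar_def
  squat_eq_iff

lemma cnj_mult_self: "sq_cnj x * x = sq_norm x *\<^sub>R 1"
  by (simp add: squat_coordinates power2_eq_square algebra_simps)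

lemma mult_cnj_self: "x * sq_cnj x = sq_norm x *\<^sub>R 1"
  by (simp add: squat_coordinates power2_eq_square algebra_simps)

lemma cnj_mult: "sq_cnj (x * y) = sq_cnj y * sq_cnj x"
  by (simp add: squat_coordinates algebra_simps)

lemma cnj_cnj [simp]: "sq_cnj (sq_cnj x) = x"
  by (simp add: squat_coordinates)

lemma cnj_mult_polar: "sq_cnj x * y + sq_cnj y * x = sq_polar x y *\<^sub>R 1"
  by (simp add: squat_coordinates algebra_simps)

lemma mult_cnj_polar: "x * sq_cnj y + y * sq_cnj x = sq_polar x y *\<^sub>R 1"
  by (simp add: squat_coordinates algebra_simps)

lemma cnj_eq_trace: "sq_cnj x = sq_polar 1 x *\<^sub>R 1 - x"
  by (simp add: squat_coordinates)

lemma square_eq: "x * x = sq_polar 1 x *\<^sub>R x - sq_norm x *\<^sub>R 1"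
  by (simp add: squat_coordinates power2_eq_square algebra_simps)

lemma norm_mult: "sq_norm (x * y) = sq_norm x * sq_norm y"
  by (simp add: squat_coordinates power2_eq_square algebra_simps)

lemma norm_cnj [simp]: "sq_norm (sq_cnj x) = sq_norm x"
  by (simp add: squat_coordinates)

lemma norm_scaleR: "sq_norm (r *\<^sub>R x) = r\<^sup>2 * sq_norm x"
  by (simp add: squat_coordinates power2_eq_square algebra_simps)

lemma norm_minus: "sq_norm (- x) = sq_norm x"
  by (simp add: squat_coordinates)

lemma norm_one: "sq_norm 1 = 1"
  by (simp add: squat_coordinates)

lemma norm_add: "sq_norm (x + y) = sq_norm x + sq_polar x y + sq_norm y"
  by (simp add: squat_coordinates power2_eq_square algebra_simps)

lemma norm_diff: "sq_norm (x - y) = sq_norm x - sq_polar x y + sq_norm y"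
  by (simp add: squat_coordinates power2_eq_square algebra_simps)

lemma polar_commute: "sq_polar x y = sq_polar y x"
  by (simp add: squat_coordinates algebra_simps)

lemma polar_add_right: "sq_polar x (y + z) = sq_polar x y + sq_polar x z"
  by (simp add: squat_coordinates algebra_simps)

lemma polar_add_left: "sq_polar (x + y) z = sq_polar x z + sq_polar y z"
  by (simp add: squat_coordinates algebra_simps)

lemma polar_scaleR_right: "sq_polar x (r *\<^sub>R y) = r * sq_polar x y"
  by (simp add: squat_coordinates algebra_simps)

lemma polar_scaleR_left: "sq_polar (r *\<^sub>R x) y = r * sq_polar x y"
  by (simp add: squat_coordinates algebra_simps)

lemma polar_minus_right: "sq_polar x (- y) = - sq_polar x y"
  by (simp add: squat_coordinates)

lemma polar_minus_left: "sq_polar (- x) y = - sq_polar x y"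
  by (simp add: squat_coordinates)

lemma polar_diff_right: "sq_polar x (y - z) = sq_polar x y - sq_polar x z"
  by (simp add: squat_coordinates algebra_simps)

lemma polar_diff_left: "sq_polar (x - y) z = sq_polar x z - sq_polar y z"
  by (simp add: squat_coordinates algebra_simps)

lemma polar_one_one: "sq_polar 1 1 = 2"
  by (simp add: squat_coordinates)

lemmas form_simps = norm_add norm_diff norm_scaleR norm_minus norm_one polar_add_right polar_add_left
  polar_scaleR_right polar_scaleR_left polar_minus_left polar_minus_right
  polar_diff_left polar_diff_right polar_one_one

lemma polar_mult_right: "sq_polar x (y * z) = sq_polar (sq_cnj y * x) z"
  by (simp add: squat_coordinates algebra_simps)

lemma polar_nondegenerate:
  assumes "x \<noteq> 0"
  obtains y where "sq_polar x y = 1"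
proof -
  \<comment> \<open>Flipping the signs of the two negative coordinates turns the form into the Euclidean one.\<close>
  define y where "y = SQuat (sq_Re x) (- sq_I x) (- sq_J x) (sq_K x)"
  have "sq_polar x y = 2 * ((sq_Re x)\<^sup>2 + (sq_I x)\<^sup>2 + (sq_J x)\<^sup>2 + (sq_K x)\<^sup>2)"
    by (simp add: y_def sq_polar_def power2_eq_square)
  moreover have "(sq_Re x)\<^sup>2 + (sq_I x)\<^sup>2 + (sq_J x)\<^sup>2 + (sq_K x)\<^sup>2 \<noteq> 0"
    using assms by (simp add: zero_squat_def squat_eq_iff add_nonneg_eq_0_iff)
  ultimately have "sq_polar x y \<noteq> 0"
    by simp
  then have "sq_polar x ((1 / sq_polar x y) *\<^sub>R y) = 1"
    by (simp add: polar_scaleR_right)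
  then show thesis
    by (rule that)
qed

text \<open>
  Independent vectors give independent functionals, because the form is nondegenerate. The
  witness comes from one elimination step: \<open>y0\<close> adjusts the first value, and \<open>y2\<close>, which is
  orthogonal to \<open>p\<close>, then adjusts the second.
\<close>

lemma prescribed_polar_values:
  assumes "p \<noteq> 0" and indep: "\<And>r. q \<noteq> r *\<^sub>R p"
  obtains y where "sq_polar p y = \<alpha>" "sq_polar q y = \<beta>"
proof -
  obtain y0 where y0: "sq_polar p y0 = 1"
    using polar_nondegenerate[OF \<open>p \<noteq> 0\<close>] .
  have "q + (- sq_polar q y0) *\<^sub>R p \<noteq> 0"
    using indep[of "sq_polar q y0"] by simp
  then obtain y1 where y1: "sq_polar (q + (- sq_polar q y0) *\<^sub>R p) y1 = 1"
    by (rule polar_nondegenerate)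
  define y2 where "y2 = y1 + (- sq_polar p y1) *\<^sub>R y0"
  have "sq_polar p y2 = 0" "sq_polar q y2 = 1"
    using y0 y1 by (simp_all add: y2_def form_simps algebra_simps)
  then show thesis
    using y0 by (intro that[of "\<alpha> *\<^sub>R y0 + (\<beta> - \<alpha> * sq_polar q y0) *\<^sub>R y2"])
      (simp_all add: form_simps)
qed

section \<open>Null planes\<close>

text \<open>
  Matrices of rank at most one all of whose linear combinations have rank at most one share
  their image or their kernel. Without matrices: the hypotheses make \<open>A = sq_cnj p * q\<close>
  and \<open>B = p * sq_cnj q\<close> skew under conjugation and imply \<open>A * y * B = 0\<close> for all \<open>y\<close>,
  and the algebra is prime.
\<close>

lemma null_plane_cases:
  assumes p: "sq_norm p = 0" and q: "sq_norm q = 0" and pq: "sq_polar p q = 0"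
  shows "sq_cnj p * q = 0 \<or> p * sq_cnj q = 0"
proof (rule disjCI)
  assume B: "p * sq_cnj q \<noteq> 0"
  define A where "A = sq_cnj p * q"
  define B where "B = p * sq_cnj q"
  have B_skew: "B = - (q * sq_cnj p)"
    using mult_cnj_polar[of p q] pq by (simp add: B_def eq_neg_iff_add_eq_0)
  have A_skew: "A = - (sq_cnj q * p)"
    using cnj_mult_polar[of p q] pq by (simp add: A_def eq_neg_iff_add_eq_0)
  have cnj_B: "sq_cnj B = - B"
    unfolding B_def cnj_mult cnj_cnj using B_skew by (simp add: B_def)
  \<comment> \<open>Skewness of \<open>B\<close> brings \<open>q\<close> to the right of \<open>y\<close>. Replacing \<open>q * y\<close> by its trace minus its
    conjugate then produces the null products \<open>sq_cnj q * q\<close> and, by skewness of \<open>A\<close>, \<open>p * sq_cnj p\<close>.\<close>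
  have AB: "A * y * B = 0" for y
  proof -
    have "q * y + sq_cnj y * sq_cnj q = sq_polar 1 (q * y) *\<^sub>R 1"
      using mult_cnj_polar[of "q * y" 1] by (simp add: squat_coordinates algebra_simps)
    then have qy: "q * y = sq_polar 1 (q * y) *\<^sub>R 1 - sq_cnj y * sq_cnj q"
      by (simp add: eq_diff_eq)
    have "A * y * B = - (sq_cnj p * (q * y) * q * sq_cnj p)"
      by (simp add: A_def B_skew mult.assoc)
    also have "\<dots> = - (sq_polar 1 (q * y) *\<^sub>R (sq_cnj p * q * sq_cnj p))
        + sq_cnj p * sq_cnj y * (sq_cnj q * q) * sq_cnj p"
      by (subst qy) (simp add: algebra_simps)
    also have "\<dots> = - (sq_polar 1 (q * y) *\<^sub>R (A * sq_cnj p))"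
      by (simp add: cnj_mult_self q A_def)
    also have "A * sq_cnj p = - (sq_cnj q * (p * sq_cnj p))"
      by (simp add: A_skew mult.assoc)
    also have "\<dots> = 0"
      by (simp add: mult_cnj_self p)
    finally show ?thesis
      by simp
  qed
  have "sq_cnj B \<noteq> 0"
    unfolding cnj_B using B by (simp add: B_def)
  then obtain s where s: "sq_polar (sq_cnj B) s = 1"
    by (rule polar_nondegenerate)
  have "B * s + sq_cnj s * sq_cnj B = 1"
    using cnj_mult_polar[of "sq_cnj B" s] s by simp
  then have "A = A * (B * s - sq_cnj s * B)"
    by (simp add: cnj_B)
  also have "\<dots> = A * 1 * B * s - A * sq_cnj s * B"
    by (simp add: algebra_simps)
  also have "\<dots> = 0"
    by (simp only: AB) simp
  finally show "sq_cnj p * q = 0"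
    by (simp add: A_def)
qed

section \<open>Right roots from quadratic factors of the norm polynomial\<close>

lemma right_root_if_invertible:
  assumes k: "sq_norm p \<noteq> 0"
    and q: "sq_norm q = sq_norm p * \<delta>" and pq: "sq_polar p q = - (sq_norm p * \<tau>)"
  shows "\<exists>h. p * h + q = 0 \<and> h * h = \<tau> *\<^sub>R h - \<delta> *\<^sub>R 1"
proof -
  define k where "k = sq_norm p"
  define h where "h = (- 1 / k) *\<^sub>R (sq_cnj p * q)"
  have "p * h = (- 1 / k) *\<^sub>R ((p * sq_cnj p) * q)"
    by (simp add: h_def mult.assoc)
  also have "\<dots> = - q"
    using k by (simp add: mult_cnj_self k_def)
  finally have "p * h + q = 0"
    by simp
  moreover have "sq_norm h = \<delta>"
    using k by (simp add: h_def norm_minus norm_scaleR norm_mult q k_def power2_eq_square)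
  moreover have "sq_polar 1 h = \<tau>"
    using k by (simp add: h_def form_simps polar_mult_right pq k_def)
  ultimately show ?thesis
    using square_eq[of h] by auto
qed

text \<open>
  Any \<open>s\<close> with \<open>sq_polar (sq_cnj p) s = 1\<close> satisfies \<open>p * s * q = q\<close>, so \<open>- s * q\<close> solves
  \<open>p h + q = 0\<close>. Adding \<open>sq_cnj p * y\<close> preserves this, and it changes trace and norm of
  \<open>h\<close> by \<open>sq_polar p y\<close> and \<open>- sq_polar q y\<close>, which take any pair of values.
\<close>

lemma right_root_if_common_image:
  assumes p: "sq_norm p = 0" and image: "sq_cnj p * q = 0"
    and "p \<noteq> 0" and indep: "\<And>r. q \<noteq> r *\<^sub>R p"
  shows "\<exists>h. p * h + q = 0 \<and> h * h = \<tau> *\<^sub>R h - \<delta> *\<^sub>R 1"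
proof -
  have "sq_cnj p \<noteq> 0"
    using \<open>p \<noteq> 0\<close> by (auto simp: squat_coordinates)
  then obtain s where s: "sq_polar (sq_cnj p) s = 1"
    by (rule polar_nondegenerate)
  define h0 where "h0 = - (s * q)"
  have "p * s = 1 - sq_cnj s * sq_cnj p"
    using cnj_mult_polar[of "sq_cnj p" s] s by (simp add: eq_diff_eq)
  then have "p * s * q = q - sq_cnj s * (sq_cnj p * q)"
    by (simp only: left_diff_distrib mult_1_left mult.assoc)
  then have h0: "p * h0 = - q"
    by (simp add: h0_def image mult.assoc)
  obtain y where y: "sq_polar p y = \<tau> - sq_polar 1 h0" "sq_polar q y = sq_norm h0 - \<delta>"
    using prescribed_polar_values[OF \<open>p \<noteq> 0\<close> indep] .
  define h where "h = h0 + sq_cnj p * y"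
  have "p * h = p * h0 + (p * sq_cnj p) * y"
    by (simp add: h_def algebra_simps)
  then have "p * h + q = 0"
    by (simp add: h0 mult_cnj_self p)
  moreover have "sq_polar 1 h = \<tau>"
    by (simp add: h_def polar_add_right polar_mult_right y)
  moreover have "sq_polar h0 (sq_cnj p * y) = - sq_polar q y"
    by (simp add: polar_mult_right h0 polar_minus_left)
  then have "sq_norm h = \<delta>"
    by (simp add: h_def norm_add norm_mult p y)
  ultimately show ?thesis
    using square_eq[of h] by auto
qed

section \<open>Real quartics\<close>

text \<open>
  The four equations compare the coefficients of \<open>t\<^sup>4 + a3 t\<^sup>3 + a2 t\<^sup>2 + a1 t + a0\<close> and
  \<open>(t\<^sup>2 - \<tau> t + \<delta>) (t\<^sup>2 + m t + n)\<close>; the first factor is chosen with roots \<open>z\<close> and its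
  complex conjugate.
\<close>

lemma quadratic_factor_if_nonreal_root:
  fixes a3 a2 a1 a0 :: real and z :: complex
  assumes root: "z ^ 4 + a3 * z ^ 3 + a2 * z\<^sup>2 + a1 * z + a0 = 0" and "Im z \<noteq> 0"
  shows "\<exists>\<tau> \<delta> m n :: real. a3 = m - \<tau> \<and> a2 = n + \<delta> - \<tau> * m \<and> a1 = \<delta> * m - \<tau> * n \<and> a0 = \<delta> * n"
proof -
  define \<tau> where "\<tau> = 2 * Re z"
  define \<delta> where "\<delta> = (Re z)\<^sup>2 + (Im z)\<^sup>2"
  have z2: "z\<^sup>2 = \<tau> * z - \<delta>"
    by (simp add: \<tau>_def \<delta>_def complex_eq_iff power2_eq_square)
  define m where "m = a3 + \<tau>"
  define n where "n = a2 - \<delta> + \<tau> * m"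
  define e where "e = a1 - (\<delta> * m - \<tau> * n)"
  define f where "f = a0 - \<delta> * n"
  \<comment> \<open>The remainder of the quartic modulo \<open>t\<^sup>2 - \<tau> t + \<delta>\<close> is the real linear polynomial \<open>e t + f\<close>.\<close>
  have "z ^ 4 + a3 * z ^ 3 + a2 * z\<^sup>2 + a1 * z + a0
      = (z\<^sup>2 - \<tau> * z + \<delta>) * (z\<^sup>2 + m * z + n) + (e * z + f)"
    by (simp add: m_def n_def e_def f_def algebra_simps power2_eq_square power3_eq_cube power4_eq_xxxx)
  then have ef: "e * z + f = 0"
    using root by (simp add: z2)
  have "e * Im z = 0"
    using arg_cong[OF ef, of Im] by simp
  then have "e = 0"
    using \<open>Im z \<noteq> 0\<close> by simp
  then have "f = 0"
    using ef by simp
  from \<open>e = 0\<close> \<open>f = 0\<close> show ?thesis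
    by (intro exI[of _ \<tau>] exI[of _ \<delta>] exI[of _ m] exI[of _ n])
      (simp add: m_def n_def e_def f_def)
qed

text \<open>
  A nonreal root gives a factor by the previous lemma. Otherwise there is a real root, and the
  cubic quotient has either a nonreal root, which is also a root of the quartic, or a second
  real root.
\<close>

lemma real_quartic_factors:
  fixes a3 a2 a1 a0 :: real
  shows "\<exists>\<tau> \<delta> m n :: real. a3 = m - \<tau> \<and> a2 = n + \<delta> - \<tau> * m \<and> a1 = \<delta> * m - \<tau> * n \<and> a0 = \<delta> * n"
    (is ?factors)
proof -
  have nonreal: ?factors
    if "z ^ 4 + a3 * z ^ 3 + a2 * z\<^sup>2 + a1 * z + a0 = 0" "Im z \<noteq> 0" for z :: complex
    using quadratic_factor_if_nonreal_root[OF that] .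
  have "\<not> constant (poly [:complex_of_real a0, of_real a1, of_real a2, of_real a3, 1:])"
    by (simp add: constant_degree)
  then obtain z :: complex where z: "z ^ 4 + a3 * z ^ 3 + a2 * z\<^sup>2 + a1 * z + a0 = 0"
    using fundamental_theorem_of_algebra
    by (fastforce simp: algebra_simps power2_eq_square power3_eq_cube power4_eq_xxxx)
  show ?thesis
  proof (cases "Im z = 0")
    case False
    then show ?thesis
      using nonreal z by blast
  next
    case True
    define x where "x = Re z"
    have z_x: "z = of_real x"
      using True by (simp add: x_def complex_eq_iff)
    \<comment> \<open>Divide by \<open>t - x\<close> and take a root \<open>w\<close> of the cubic quotient.\<close>
    define b2 where "b2 = a3 + x"
    define b1 where "b1 = a2 + b2 * x"
    define b0 where "b0 = a1 + b1 * x"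
    have "complex_of_real (x ^ 4 + a3 * x ^ 3 + a2 * x\<^sup>2 + a1 * x + a0) = 0"
      using z by (simp add: z_x)
    then have "x ^ 4 + a3 * x ^ 3 + a2 * x\<^sup>2 + a1 * x + a0 = 0"
      by (simp only: of_real_eq_0_iff)
    then have a0: "a0 = - (b0 * x)"
      by (simp add: b2_def b1_def b0_def algebra_simps power2_eq_square power3_eq_cube
          power4_eq_xxxx)
    have "\<not> constant (poly [:complex_of_real b0, of_real b1, of_real b2, 1:])"
      by (simp add: constant_degree)
    then obtain w :: complex where w: "w ^ 3 + b2 * w\<^sup>2 + b1 * w + b0 = 0"
      using fundamental_theorem_of_algebra
      by (fastforce simp: algebra_simps power2_eq_square power3_eq_cube)
    show ?thesis
    proof (cases "Im w = 0")
      case False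
      have "w ^ 4 + a3 * w ^ 3 + a2 * w\<^sup>2 + a1 * w + a0
          = (w - x) * (w ^ 3 + b2 * w\<^sup>2 + b1 * w + b0)"
        by (simp add: a0) (simp add: b2_def b1_def b0_def algebra_simps power2_eq_square
            power3_eq_cube power4_eq_xxxx)
      then show ?thesis
        using nonreal[of w] False w by simp
    next
      case True
      define v where "v = Re w"
      have w_v: "w = of_real v"
        using True by (simp add: v_def complex_eq_iff)
      have "complex_of_real (v ^ 3 + b2 * v\<^sup>2 + b1 * v + b0) = 0"
        using w by (simp add: w_v)
      then have "v ^ 3 + b2 * v\<^sup>2 + b1 * v + b0 = 0"
        by (simp only: of_real_eq_0_iff)
      then have b0: "b0 = - (v ^ 3 + b2 * v\<^sup>2 + b1 * v)"
        by simp
      have a: "a3 = b2 - x" "a2 = b1 - b2 * x" "a1 = b0 - b1 * x"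
        by (simp_all add: b2_def b1_def b0_def)
      show ?thesis
        by (intro exI[of _ "x + v"] exI[of _ "x * v"] exI[of _ "b2 + v"]
            exI[of _ "b1 + (b2 + v) * v"])
          (simp add: a a0 b0 algebra_simps power2_eq_square power3_eq_cube)
    qed
  qed
qed

section \<open>Factorization of quadratic polynomials\<close>

lemma monic_quadratic_right_root:
  fixes b c :: squat
  assumes indep: "\<And>r s t. r *\<^sub>R 1 + s *\<^sub>R b + t *\<^sub>R c = 0 \<Longrightarrow> s = 0 \<and> t = 0"
  shows "\<exists>h. h * h + b * h + c = 0"
proof -
  obtain \<tau> \<delta> m n where factors:
    "sq_polar 1 b = m - \<tau>" "sq_norm b + sq_polar 1 c = n + \<delta> - \<tau> * m"
    "sq_polar b c = \<delta> * m - \<tau> * n" "sq_norm c = \<delta> * n"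
    using real_quartic_factors by meson
  define p where "p = b + \<tau> *\<^sub>R 1"
  define q where "q = c + (- \<delta>) *\<^sub>R 1"
  have right_root: "\<exists>h. h * h + b * h + c = 0"
    if "\<exists>h. (b + \<tau>' *\<^sub>R 1) * h + (c + (- \<delta>') *\<^sub>R 1) = 0 \<and> h * h = \<tau>' *\<^sub>R h - \<delta>' *\<^sub>R 1"
    for \<tau>' \<delta>'
  proof -
    obtain h where h: "(b + \<tau>' *\<^sub>R 1) * h + (c + (- \<delta>') *\<^sub>R 1) = 0" "h * h = \<tau>' *\<^sub>R h - \<delta>' *\<^sub>R 1"
      using \<open>\<exists>h. _ h\<close> by blast
    have "h * h + b * h + c = (b + \<tau>' *\<^sub>R 1) * h + (c + (- \<delta>') *\<^sub>R 1)"
      by (simp add: h(2) algebra_simps)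
    then show ?thesis
      using h(1) by metis
  qed
  \<comment> \<open>The coefficients of the norm of \<open>p t + q\<close> are those of \<open>k (t\<^sup>2 - \<tau> t + \<delta>)\<close>, with \<open>k = sq_norm p\<close>.\<close>
  have m: "m = sq_polar 1 b + \<tau>"
    using factors(1) by simp
  have norm_p: "sq_norm p = n + \<delta> - sq_polar 1 c"
    using factors(2)
    by (simp add: p_def m form_simps polar_commute[of _ 1] algebra_simps power2_eq_square)
  have norm_q: "sq_norm q = sq_norm p * \<delta>"
    unfolding norm_p using factors
    by (simp add: q_def form_simps polar_commute[of _ 1] algebra_simps power2_eq_square)
  have polar_pq: "sq_polar p q = - (sq_norm p * \<tau>)"
    unfolding norm_p using factors(3)
    by (simp add: p_def q_def m form_simps polar_commute[of b 1] algebra_simps)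
  have indep_shifted: "b + r *\<^sub>R 1 \<noteq> 0" "c + r *\<^sub>R 1 \<noteq> s *\<^sub>R (b + t *\<^sub>R 1)" for r s t
    using indep[of r 1 0] indep[of "r - s * t" "- s" 1] by (auto simp: algebra_simps)
  consider (invertible) "sq_norm p \<noteq> 0"
    | (image) "sq_norm p = 0" "sq_cnj p * q = 0"
    | (kernel) "sq_norm p = 0" "p * sq_cnj q = 0"
    using null_plane_cases[of p q] norm_q polar_pq by auto
  then show ?thesis
  proof cases
    case invertible
    then show ?thesis
      using right_root_if_invertible[OF invertible norm_q polar_pq] right_root
      unfolding p_def q_def by blast
  next
    case image
    then show ?thesis
      using right_root_if_common_image[of p q] right_root indep_shifted
      unfolding p_def q_def by blast
  next
    case kernel
    \<comment> \<open>The remainder modulo the other factor \<open>t\<^sup>2 + m t + n\<close> is \<open>- cnj p t - cnj q\<close>.\<close>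
    have p': "b + (- m) *\<^sub>R 1 = - sq_cnj p"
      using factors by (simp add: cnj_eq_trace p_def form_simps algebra_simps flip: scaleR_add_left)
    have q': "c + (- n) *\<^sub>R 1 = - sq_cnj q"
      using factors kernel(1) norm_p
      by (simp add: cnj_eq_trace q_def form_simps algebra_simps flip: scaleR_add_left)
    have "sq_norm (b + (- m) *\<^sub>R 1) = 0"
      unfolding p' by (simp add: norm_minus kernel(1))
    moreover have "sq_cnj (b + (- m) *\<^sub>R 1) * (c + (- n) *\<^sub>R 1) = 0"
      using kernel(2) unfolding p' q' by (simp add: squat_coordinates)
    ultimately show ?thesis
      using right_root_if_common_image[of "b + (- m) *\<^sub>R 1" "c + (- n) *\<^sub>R 1"]
        right_root[of "- m" n] indep_shifted by blast
  qed
qed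

lemma right_root_gives_factorization:
  assumes "h * h + b * h + c = 0"
  shows "const a * indet ^ 2 + const (a * b) * indet + const (a * c)
    = const a * (indet - const (- b - h)) * (indet - const h)"
proof -
  have c: "c = (- b - h) * h"
    using assms by (simp add: algebra_simps eq_neg_iff_add_eq_0)
  show ?thesis
    unfolding indet_power c
    by (rule poly_mapping_eqI)
      (simp add: mult_single algebra_simps lookup_add lookup_minus lookup_single when_def)
qed

theorem theorem5:
  fixes C :: squat_poly and c0 c1 c2 :: squat
  assumes "C = const c2 * indet ^ 2 + const c1 * indet + const c0"
    and "\<exists>u. c2 * u = 1 \<and> u * c2 = 1"
    and "distinct [c0, c1, c2]" and "independent {c0, c1, c2}"
  shows "\<exists>h1 h2. C = const c2 * (indet - const h1) * (indet - const h2)"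
proof -
  obtain u where u: "c2 * u = 1" "u * c2 = 1"
    using assms(2) by blast
  have "s = 0 \<and> t = 0" if "r *\<^sub>R 1 + s *\<^sub>R (u * c1) + t *\<^sub>R (u * c0) = 0" for r s t
  proof -
    define g where "g = (\<lambda>_. 0)(c0 := t, c1 := s, c2 := r)"
    have "r *\<^sub>R c2 + s *\<^sub>R c1 + t *\<^sub>R c0 = c2 * (r *\<^sub>R 1 + s *\<^sub>R (u * c1) + t *\<^sub>R (u * c0))"
      using u by (simp add: distrib_left flip: mult.assoc)
    also have "\<dots> = 0"
      by (simp only: that mult_zero_right)
    finally have "(\<Sum>v\<in>{c0, c1, c2}. g v *\<^sub>R v) = 0"
      using assms(3) by (simp add: g_def algebra_simps)
    then have "g v = 0" if "v \<in> {c0, c1, c2}" for v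
      using independentD[OF assms(4), of "{c0, c1, c2}" g v] that by simp
    from this[of c0] this[of c1] show ?thesis
      using assms(3) by (simp add: g_def)
  qed
  then obtain h where "h * h + u * c1 * h + u * c0 = 0"
    using monic_quadratic_right_root[of "u * c1" "u * c0"] by blast
  from right_root_gives_factorization[OF this, of c2]
  have "C = const c2 * (indet - const (- (u * c1) - h)) * (indet - const h)"
    using u by (simp add: assms(1) flip: mult.assoc)
  then show ?thesis
    by blast
qed

end
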